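(* Let $F$ be a clause-set with all clauses of length $1$ or $2$, let $\{x\}\in F$, and let $L$ be a linear order on the literals of $F$. The procedure $\mathrm{enum}(F,\{x\},L)$ prints exactly the elements of $\mathrm{mus}_{\{x\}}(F)$ (the minimally unsatisfiable subsets of $F$ containing $\{x\}$), each exactly once, in $L$-pathlex order.
   Context: Literals are variables and complements ($\overline{\overline x}=x$); clauses are finite sets of literals without complementary pair; clause-sets are finite sets of clauses; minimally unsatisfiable = unsatisfiable but removing any clause makes it satisfiable. The implication digraph $G=\mathrm{idg}(F)$ has vertex set all literals whose variable occurs in $F$; binary clause $\{a,b\}$ yields arcs $(\overline a,b),(\overline b,a)$; unit-clause $\{a\}$ yields arc $(\overline a,a)$, and arcs of form $(a,\overline a)$ are called units. For an arc set $A$, $\mathcal{CL}(A)=\{\{\overline a,b\}:(a,b)\in A\}$. Paths have distinct vertices; regular = no complementary pair among vertices; nearly regular = exactly one complementary pair among its vertices and regular after removing the last vertex; $\mathfrak U_z(G)$ = nearly regular paths starting at $z$; $F(P)=\mathcal{CL}(E(P))\cup\{\{z\}\}$ for $P\in\mathfrak U_z(G)$. For a nearly regular $P$ with last vertex $w$, the regular decomposition $P=P_0;P_1$ splits $P$ at the vertex $\overline w$ ($P_0$ from start to $\overline w$, $P_1$ from $\overline w$ to $w$); the contraposition $\overline Q$ of a path $Q$ replaces each arc $(a,b)$ by $(\overline b,\overline a)$ in reversed order. $L$-pathlex order: paths are compared lexicographically as words of literals, comparing literals by $L$. For a minimally unsatisfiable subset $F'$ of $F$ containing at least one unit-clause,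 let $x(F')$ be the $L$-smallest literal $z$ with $\{z\}\in F'$ (there are at most two), let $P(F')$ be the lexicographically smaller of the (at most two) paths $P\in\mathfrak U_{x(F')}(G)$ with $F(P)=F'$; then $F'<_L F''$ iff $P(F')<_L P(F'')$. Procedure $\mathrm{enum}(F,\{x\},L)$: if $\overline x$ is reachable from $x$ in $G$, call DFS with empty path and vertex $x$. DFS$(P,y)$: set $P:=P;y$ (append $y$). If $V(P)$ contains a complementary pair, call OUTPUT$(P)$. Otherwise compute $R$ = set of out-neighbours $z$ of $y$ in $G - V(P)$ from which $\overline x$ is reachable in $G-V(P)$, and for each $z\in R$ in order $L$ call DFS$(P,z)$. OUTPUT$(P)$: if the last arc of $P$ is a unit, print $F(P)=\mathcal{CL}(E(P))\cup\{\{x\}\}$; otherwise, with regular decomposition $P=P_0;P_1$, let $P'=P_0;\overline{P_1}$ and print $F(P)$ only if $P<_L P'$.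
   Formalization: The order claim can fail when a printed set contains a second unit-clause {z} with z before x in L; here sets are compared by their lexicographically smallest paths starting at x, and the original L-pathlex order is shown for the printed sets F' with x(F')=x. *)

theory Defs
  imports "Graph_Theory.Graph_Theory"
begin

section \<open>Clause-sets\<close>

datatype 'v lit = Pos 'v | Neg 'v

fun var :: "'v lit \<Rightarrow> 'v" where
  "var (Pos v) = v"
| "var (Neg v) = v"

fun neg :: "'v lit \<Rightarrow> 'v lit" where
  "neg (Pos v) = Neg v"
| "neg (Neg v) = Pos v"

lemma neg_neg [simp]: "neg (neg a) = a"
  by (cases a) auto

type_synonym 'v clause = "'v lit set"

definition is_clause :: "'v clause \<Rightarrow> bool" where
  "is_clause C \<longleftrightarrow> finite C \<and> \<not> (\<exists>a. a \<in> C \<and> neg a \<in> C)"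

definition is_clause_set :: "'v clause set \<Rightarrow> bool" where
  "is_clause_set F \<longleftrightarrow> finite F \<and> (\<forall>C\<in>F. is_clause C)"

definition lits :: "'v clause set \<Rightarrow> 'v lit set" where
  "lits F = {a. \<exists>C\<in>F. \<exists>b\<in>C. var a = var b}"

fun lit_true :: "('v \<Rightarrow> bool) \<Rightarrow> 'v lit \<Rightarrow> bool" where
  "lit_true \<phi> (Pos v) \<longleftrightarrow> \<phi> v"
| "lit_true \<phi> (Neg v) \<longleftrightarrow> \<not> \<phi> v"

definition satisfiable :: "'v clause set \<Rightarrow> bool" where
  "satisfiable F \<longleftrightarrow> (\<exists>\<phi>. \<forall>C\<in>F. \<exists>a\<in>C. lit_true \<phi> a)"

definition min_unsat :: "'v clause set \<Rightarrow> bool" where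
  "min_unsat F \<longleftrightarrow> \<not> satisfiable F \<and> (\<forall>C\<in>F. satisfiable (F - {C}))"

definition mus_containing :: "'v clause \<Rightarrow> 'v clause set \<Rightarrow> 'v clause set set" where
  "mus_containing C F = {F'. F' \<subseteq> F \<and> min_unsat F' \<and> C \<in> F'}"

section \<open>Implication digraphs and paths\<close>

text \<open>
  The case \<open>a = b\<close> covers the unit-clauses: the clause \<open>{a} = {a, a}\<close> yields the arc
  \<open>(neg a, a)\<close>.  A binary clause \<open>{a, b} = {b, a}\<close> yields both of its arcs.
\<close>

definition idg :: "'v clause set \<Rightarrow> ('v lit, 'v lit \<times> 'v lit) pre_digraph" where
  "idg F = \<lparr> verts = lits F, arcs = {(neg a, b) | a b. {a, b} \<in> F}, tail = fst, head = snd \<rparr>"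

definition is_unit_arc :: "'v lit \<times> 'v lit \<Rightarrow> bool" where
  "is_unit_arc e \<longleftrightarrow> snd e = neg (fst e)"

definition arc_clauses :: "('v lit \<times> 'v lit) set \<Rightarrow> 'v clause set" where
  "arc_clauses A = {{neg a, b} | a b. (a, b) \<in> A}"

text \<open>Paths are given by their lists of vertices, as in \<^const>\<open>vpath\<close>.\<close>

definition compl_pairs :: "'v lit list \<Rightarrow> 'v lit set set" where
  "compl_pairs P = {{a, neg a} | a. a \<in> set P \<and> neg a \<in> set P}"

definition regular :: "'v lit list \<Rightarrow> bool" where
  "regular P \<longleftrightarrow> compl_pairs P = {}"

definition nearly_regular :: "'v lit list \<Rightarrow> bool" where
  "nearly_regular P \<longleftrightarrow> card (compl_pairs P) = 1 \<and> regular (butlast P)"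

definition nr_paths :: "('v lit, 'b) pre_digraph \<Rightarrow> 'v lit \<Rightarrow> 'v lit list set" where
  "nr_paths G z = {P. vpath P G \<and> hd P = z \<and> nearly_regular P}"

definition path_clauses :: "'v lit list \<Rightarrow> 'v clause set" where
  "path_clauses P = arc_clauses (set (vwalk_arcs P)) \<union> {{hd P}}"

text \<open>
  The two parts of the regular decomposition share the splitting vertex \<open>neg (last P)\<close>, which
  \<^const>\<open>vwalk_join\<close> identifies again.
\<close>

definition reg_decomp :: "'v lit list \<Rightarrow> 'v lit list \<times> 'v lit list" where
  "reg_decomp P = (let v = neg (last P) in
     (takeWhile (\<lambda>a. a \<noteq> v) P @ [v], dropWhile (\<lambda>a. a \<noteq> v) P))"

definition contrapos :: "'v lit list \<Rightarrow> 'v lit list" where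
  "contrapos Q = rev (map neg Q)"

definition flip :: "'v lit list \<Rightarrow> 'v lit list" where
  "flip P = (case reg_decomp P of (P0, P1) \<Rightarrow> P0 \<oplus> contrapos P1)"

section \<open>The pathlex order\<close>

text \<open>A linear order on literals is a reflexive relation \<open>L\<close> as in \<^const>\<open>linear_order_on\<close>.\<close>

definition path_less :: "'v lit rel \<Rightarrow> 'v lit list \<Rightarrow> 'v lit list \<Rightarrow> bool" where
  "path_less L P Q \<longleftrightarrow> (P, Q) \<in> lexord (L - Id)"

definition first_path :: "'v clause set \<Rightarrow> 'v lit rel \<Rightarrow> 'v lit \<Rightarrow> 'v clause set \<Rightarrow> 'v lit list" where
  "first_path F L z F' = (THE P. P \<in> nr_paths (idg F) z \<and> path_clauses P = F' \<and>
     (\<forall>Q \<in> nr_paths (idg F) z. path_clauses Q = F' \<and> Q \<noteq> P \<longrightarrow> path_less L P Q))"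

definition start_lit :: "'v lit rel \<Rightarrow> 'v clause set \<Rightarrow> 'v lit" where
  "start_lit L F' = (THE z. {z} \<in> F' \<and> (\<forall>z'. {z'} \<in> F' \<longrightarrow> (z, z') \<in> L))"

definition pathlex_less ::
  "'v clause set \<Rightarrow> 'v lit rel \<Rightarrow> 'v clause set \<Rightarrow> 'v clause set \<Rightarrow> bool" where
  "pathlex_less F L F' F'' \<longleftrightarrow>
     path_less L (first_path F L (start_lit L F') F') (first_path F L (start_lit L F'') F'')"

text \<open>
  The pathlex order on the minimally unsatisfiable subsets containing a given unit-clause \<open>{x}\<close>:
  all paths start at \<open>x\<close>.  It differs from \<^const>\<open>pathlex_less\<close> only when one of the sets
  contains a second unit-clause \<open>{z}\<close> with \<open>z\<close> before \<open>x\<close> in \<open>L\<close>, in which case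
  \<^const>\<open>pathlex_less\<close> reads the set from \<open>z\<close>, while every path visited by the enumeration
  below starts at \<open>x\<close>.
\<close>

definition pathlex_less_from ::
  "'v lit \<Rightarrow> 'v clause set \<Rightarrow> 'v lit rel \<Rightarrow> 'v clause set \<Rightarrow> 'v clause set \<Rightarrow> bool" where
  "pathlex_less_from x F L F' F'' \<longleftrightarrow> path_less L (first_path F L x F') (first_path F L x F'')"

lemma pathlex_less_eq_from:
  assumes "start_lit L F' = x" "start_lit L F'' = x"
  shows "pathlex_less F L F' F'' \<longleftrightarrow> pathlex_less_from x F L F' F''"
  using assms by (simp add: pathlex_less_def pathlex_less_from_def)

section \<open>The enumeration procedure\<close>

definition listing :: "'a rel \<Rightarrow> 'a set \<Rightarrow> 'a list" where
  "listing L A = (THE zs. set zs = A \<and> distinct zs \<and> sorted_wrt (\<lambda>a b. (a, b) \<in> L) zs)"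

text \<open>The literals \<open>z\<close> in the set \<open>R\<close> that is computed when the current path is \<open>P\<close>.\<close>

definition extensions :: "'v clause set \<Rightarrow> 'v lit \<Rightarrow> 'v lit list \<Rightarrow> 'v lit set" where
  "extensions F x P =
     {z \<in> verts (idg F) - set P. last P \<rightarrow>\<^bsub>idg F\<^esub> z \<and>
        z \<rightarrow>\<^sup>*\<^bsub>idg F \<restriction> (verts (idg F) - set P)\<^esub> neg x}"

text \<open>Procedures return the list of clause-sets they print, in the order of printing.\<close>

definition output_path :: "'v lit rel \<Rightarrow> 'v lit list \<Rightarrow> 'v clause set list" where
  "output_path L P =
     (if is_unit_arc (last (vwalk_arcs P)) \<or> path_less L P (flip P) then [path_clauses P] else [])"

text \<open>
  The first branch only ensures termination; it is never taken for a (finite) clause-set.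
\<close>

function dfs :: "'v clause set \<Rightarrow> 'v lit \<Rightarrow> 'v lit rel \<Rightarrow> 'v lit list \<Rightarrow> 'v lit
    \<Rightarrow> 'v clause set list" where
  "dfs F x L P y =
     (if infinite (lits F) then []
      else if \<not> regular (P @ [y]) then output_path L (P @ [y])
      else concat (map (\<lambda>z. dfs F x L (P @ [y]) z)
             [z \<leftarrow> listing L (lits F). z \<in> extensions F x (P @ [y])]))"
  by pat_completeness auto
termination
proof (relation "measure (\<lambda>(F, x, L, P, y). card (lits F - set (P @ [y])))", goal_cases)
  case 1
  show ?case by simp
next
  case (2 F x L P y z)
  then have fin: "finite (lits F)" and z: "z \<in> lits F - set (P @ [y])"
    by (auto simp: extensions_def idg_def)
  have "lits F - set ((P @ [y]) @ [z]) \<subset> lits F - set (P @ [y])"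
    using z by auto
  with fin show ?case
    by (simp only: in_measure case_prod_conv psubset_card_mono finite_Diff)
qed

declare dfs.simps [simp del]

definition enum_mus :: "'v clause set \<Rightarrow> 'v lit \<Rightarrow> 'v lit rel \<Rightarrow> 'v clause set list" where
  "enum_mus F x L = (if x \<rightarrow>\<^sup>*\<^bsub>idg F\<^esub> neg x then dfs F x L [] x else [])"

end

theory Submission
  imports Defs "HOL-Library.Sublist"
begin

text \<open>
  A nearly regular path has the form \<open>A @ u # B @ [neg u]\<close> with pairwise distinct variables in
  \<open>A @ u # B\<close>, and its clauses form a minimally unsatisfiable set; every minimally unsatisfiable
  set containing \<open>{x}\<close> arises in this way, since otherwise the literals reachable from \<open>x\<close> could
  all be made true.  Two paths from \<open>x\<close> with the same clauses can only diverge after \<open>u\<close>, where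
  the single alternative is to traverse the cycle \<open>u # B @ [neg u]\<close> contrapositively; so the
  fibres are \<open>{P, flip P}\<close>, and the output test selects the smaller member.  The search visits the
  nearly regular paths in lexicographic order, as the reachability test prunes none of them.
\<close>

section \<open>Literals\<close>

lemma var_neg [simp]: "var (neg a) = var a"
  by (cases a) auto

lemma neg_neq [simp]: "neg a \<noteq> a" "a \<noteq> neg a"
  by (cases a; simp)+

lemma neg_eq_iff [simp]: "neg a = neg b \<longleftrightarrow> a = b"
  by (metis neg_neg)

lemma var_eq_iff: "var a = var b \<longleftrightarrow> a = b \<or> a = neg b"
  by (cases a; cases b) auto

lemma lit_true_neg [simp]: "lit_true \<phi> (neg a) \<longleftrightarrow> \<not> lit_true \<phi> a"
  by (cases a) auto

text \<open>Since \<open>T\<close> contains no complementary pair, it forces at most one literal of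
  each variable, and \<phi> decides the rest. This supplies the assignments built from cut paths and
  from sets of reachable literals.\<close>

lemma ex_override:
  assumes "\<And>a. a \<in> T \<Longrightarrow> neg a \<notin> T"
  obtains \<phi>' where "\<And>a. lit_true \<phi>' a \<longleftrightarrow> a \<in> T \<or> neg a \<notin> T \<and> lit_true \<phi> a"
proof
  fix a
  show "lit_true (\<lambda>v. Pos v \<in> T \<or> Neg v \<notin> T \<and> \<phi> v) a \<longleftrightarrow> a \<in> T \<or> neg a \<notin> T \<and> lit_true \<phi> a"
    using assms by (cases a) force+
qed

text \<open>Merges distinctness and regularity into one condition on variables, which survives
  negating literals and reversing the list, hence contraposition.\<close>

lemma distinct_map_var_iff: "distinct (map var P) \<longleftrightarrow> distinct P \<and> regular P"
proof -
  have "inj_on var (set P) \<longleftrightarrow> regular P"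
    unfolding inj_on_def regular_def compl_pairs_def by (auto simp: var_eq_iff)
  then show ?thesis
    by (simp add: distinct_map)
qed

lemma distinct_map_var_neg: "distinct (map var P) \<Longrightarrow> a \<in> set P \<Longrightarrow> neg a \<notin> set P"
  unfolding distinct_map_var_iff regular_def compl_pairs_def by blast

section \<open>The implication digraph\<close>

lemma verts_idg [simp]: "verts (idg F) = lits F"
  by (simp add: idg_def)

lemma arcs_ends_idg [simp]: "(a, b) \<in> arcs_ends (idg F) \<longleftrightarrow> {neg a, b} \<in> F"
  unfolding arcs_ends_conv idg_def by (force intro: exI[of _ "neg a"])

lemma arc_in_lits: "{neg a, b} \<in> F \<Longrightarrow> a \<in> lits F \<and> b \<in> lits F"
  unfolding lits_def by (auto intro!: bexI[of _ "{neg a, b}"])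

lemma lits_neg [simp]: "neg a \<in> lits F \<longleftrightarrow> a \<in> lits F"
  by (simp add: lits_def)

lemma wf_digraph_idg: "wf_digraph (idg F)"
proof
  fix e assume "e \<in> arcs (idg F)"
  then obtain a b where "e = (neg a, b)" "{a, b} \<in> F"
    by (auto simp: idg_def)
  then show "tail (idg F) e \<in> verts (idg F)" "head (idg F) e \<in> verts (idg F)"
    using arc_in_lits[of "neg a" b F] by (auto simp: idg_def)
qed

lemma finite_lits:
  assumes "is_clause_set F"
  shows "finite (lits F)"
proof (rule finite_subset)
  show "lits F \<subseteq> \<Union>F \<union> neg ` \<Union>F"
  proof
    fix a assume "a \<in> lits F"
    then obtain C b where "C \<in> F" "b \<in> C" "a = b \<or> a = neg b"
      by (auto simp: lits_def var_eq_iff)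
    then show "a \<in> \<Union>F \<union> neg ` \<Union>F"
      by auto
  qed
  show "finite (\<Union>F \<union> neg ` \<Union>F)"
    using assms by (auto simp: is_clause_set_def is_clause_def)
qed

section \<open>Walks, their arcs and their contraposition\<close>

lemma set_vwalk_arcs: "(a, b) \<in> set (vwalk_arcs p) \<longleftrightarrow> (\<exists>xs ys. p = xs @ a # b # ys)"
proof
  assume "(a, b) \<in> set (vwalk_arcs p)"
  then show "\<exists>xs ys. p = xs @ a # b # ys"
  proof (induction p rule: vwalk_arcs.induct)
    case (3 x y xs)
    then consider "a = x" "b = y" | "\<exists>us vs. y # xs = us @ a # b # vs"
      by auto
    then show ?case
      by cases (metis append_Nil, metis append_Cons)
  qed auto
next
  assume "\<exists>xs ys. p = xs @ a # b # ys"
  then obtain xs ys where "p = xs @ a # b # ys" by blast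
  then show "(a, b) \<in> set (vwalk_arcs p)"
    using set_vwalk_arcs_append2[of "a # b # ys" xs] by auto
qed

lemma vwalk_append_iff:
  assumes "p \<noteq> []" "q \<noteq> []"
  shows "vwalk (p @ q) G \<longleftrightarrow> vwalk p G \<and> vwalk q G \<and> (last p, hd q) \<in> arcs_ends G"
  using assms by (auto simp: vwalk_def vwalk_arcs_append)

lemma contrapos_Cons [simp]: "contrapos (a # p) = contrapos p @ [neg a]"
  and contrapos_Nil [simp]: "contrapos [] = []"
  by (simp_all add: contrapos_def)

lemma contrapos_append [simp]: "contrapos (p @ q) = contrapos q @ contrapos p"
  by (simp add: contrapos_def)

lemma set_contrapos [simp]: "set (contrapos p) = neg ` set p"
  by (simp add: contrapos_def)

lemma contrapos_eq_Nil_iff [simp]: "contrapos p = [] \<longleftrightarrow> p = []"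
  by (simp add: contrapos_def)

lemma contrapos_contrapos [simp]: "contrapos (contrapos p) = p"
  by (induction p) auto

lemma map_var_contrapos [simp]: "map var (contrapos p) = rev (map var p)"
  by (simp add: contrapos_def rev_map)

lemma last_contrapos: "p \<noteq> [] \<Longrightarrow> last (contrapos p) = neg (hd p)"
  by (cases p) auto

lemma hd_contrapos: "p \<noteq> [] \<Longrightarrow> hd (contrapos p) = neg (last p)"
  by (simp add: contrapos_def hd_rev last_map)

lemma set_vwalk_arcs_contrapos:
  "set (vwalk_arcs (contrapos p)) = (\<lambda>(a, b). (neg b, neg a)) ` set (vwalk_arcs p)"
proof (induction p)
  case (Cons a p)
  show ?case
  proof (cases "p = []")
    case False
    then show ?thesis
      using Cons by (simp add: set_vwalk_arcs_snoc last_contrapos)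
  qed simp
qed simp

text \<open>Skew symmetry of the implication digraph: the arcs \<open>(a, b)\<close> and
  \<open>(neg b, neg a)\<close> come from the same clause \<open>{neg a, b}\<close>.\<close>

lemma vwalk_contrapos:
  assumes "vwalk p (idg F)"
  shows "vwalk (contrapos p) (idg F)"
proof
  show "set (contrapos p) \<subseteq> verts (idg F)" "contrapos p \<noteq> []"
    using assms by (auto simp: vwalk_def)
  show "set (vwalk_arcs (contrapos p)) \<subseteq> arcs_ends (idg F)"
    using assms by (auto simp: vwalk_def set_vwalk_arcs_contrapos insert_commute)
qed

lemma arc_clauses_Un: "arc_clauses (A \<union> B) = arc_clauses A \<union> arc_clauses B"
  by (auto simp: arc_clauses_def)

lemma arc_clauses_insert: "arc_clauses (insert (a, b) A) = insert {neg a, b} (arc_clauses A)"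
  by (auto simp: arc_clauses_def)

lemma arc_clauses_vwalk_arcs_contrapos:
  "arc_clauses (set (vwalk_arcs (contrapos p))) = arc_clauses (set (vwalk_arcs p))"
proof -
  \<comment> \<open>One inclusion suffices: contraposition is an involution, so using it for the
    walk and for its contraposition gives equality.\<close>
  have "arc_clauses ((\<lambda>(a, b). (neg b, neg a)) ` A) \<subseteq> arc_clauses A" for A :: "('a lit \<times> 'a lit) set"
    unfolding arc_clauses_def by clarsimp (metis insert_commute neg_neg)
  from this[of "set (vwalk_arcs p)"] this[of "set (vwalk_arcs (contrapos p))"]
  show ?thesis
    by (metis contrapos_contrapos set_vwalk_arcs_contrapos subset_antisym)
qed

lemma arc_clauses_subset_iff: "arc_clauses A \<subseteq> F \<longleftrightarrow> A \<subseteq> arcs_ends (idg F)"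
  unfolding arc_clauses_def by auto blast

section \<open>Nearly regular paths\<close>

text \<open>The normal form used from here on. As the part before the last vertex \<open>w\<close>
  is regular, the complementary pair must involve \<open>w\<close>, and \<open>u = neg w\<close> is
  where the stem \<open>A\<close> meets the cycle.\<close>

lemma nearly_regular_iff:
  "distinct P \<and> nearly_regular P \<longleftrightarrow>
    (\<exists>A u B. P = A @ u # B @ [neg u] \<and> distinct (map var (A @ u # B)))" (is "_ \<longleftrightarrow> ?R")
proof
  assume *: "distinct P \<and> nearly_regular P"
  then have "P \<noteq> []" by (auto simp: nearly_regular_def compl_pairs_def)
  then obtain C w where P: "P = C @ [w]" by (metis rev_exhaust)
  have dC: "distinct (map var C)"
    using * by (simp add: P distinct_map_var_iff nearly_regular_def)
  have "compl_pairs P \<noteq> {}"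
    using * by (auto simp: nearly_regular_def)
  then obtain a where a: "a \<in> set P" "neg a \<in> set P"
    by (auto simp: compl_pairs_def)
  have "\<not> (a \<in> set C \<and> neg a \<in> set C)"
    using dC by (auto simp: distinct_map_var_iff regular_def compl_pairs_def)
  then have "neg w \<in> set C"
    using a by (auto simp: P)
  then obtain A B where "C = A @ neg w # B"
    by (metis split_list)
  then show ?R
    using P dC by (intro exI[of _ A] exI[of _ "neg w"] exI[of _ B]) simp
next
  assume ?R
  then obtain A u B where P: "P = A @ u # B @ [neg u]" and d: "distinct (map var (A @ u # B))"
    by blast
  have reg: "distinct (A @ u # B)" "regular (A @ u # B)"
    using d by (simp_all only: distinct_map_var_iff)
  then have no: "\<And>a. a \<in> set (A @ u # B) \<Longrightarrow> neg a \<notin> set (A @ u # B)"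
    unfolding regular_def compl_pairs_def by blast
  have "compl_pairs P = {{u, neg u}}"
  proof
    show "compl_pairs P \<subseteq> {{u, neg u}}"
    proof
      fix p assume "p \<in> compl_pairs P"
      then obtain a where a: "p = {a, neg a}" "a \<in> set P" "neg a \<in> set P"
        by (auto simp: compl_pairs_def)
      have S: "set P = insert (neg u) (set (A @ u # B))"
        by (auto simp: P)
      have "a = neg u \<or> neg a = neg u"
        using a no unfolding S by blast
      then show "p \<in> {{u, neg u}}"
        using a by auto
    qed
    show "{{u, neg u}} \<subseteq> compl_pairs P"
      unfolding P compl_pairs_def by auto
  qed
  moreover have "distinct P"
    using reg no[of u] by (auto simp: P)
  moreover have "butlast P = A @ u # B"
    by (simp add: P butlast_append)
  ultimately show "distinct P \<and> nearly_regular P"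
    using reg by (simp add: nearly_regular_def)
qed

lemma nr_paths_iff:
  "P \<in> nr_paths G x \<longleftrightarrow> vwalk P G \<and> hd P = x \<and>
    (\<exists>A u B. P = A @ u # B @ [neg u] \<and> distinct (map var (A @ u # B)))"
  using nearly_regular_iff[of P] unfolding nr_paths_def vpath_def by auto

lemma nr_pathsE:
  assumes "P \<in> nr_paths G x"
  obtains A u B where "P = A @ u # B @ [neg u]" "distinct (map var (A @ u # B))"
    "vwalk P G" "hd P = x" "distinct P"
  using assms nearly_regular_iff[of P] unfolding nr_paths_iff by blast

section \<open>Contraposing the cycle of a nearly regular path\<close>

lemma flip_form:
  assumes "distinct (map var (A @ u # B))"
  shows "flip (A @ u # B @ [neg u]) = A @ u # contrapos B @ [neg u]"
proof -
  have "u \<notin> set A" using assms by auto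
  then have "\<And>a. a \<in> set A \<Longrightarrow> a \<noteq> u" by blast
  then have "takeWhile (\<lambda>a. a \<noteq> u) (A @ u # B @ [neg u]) = A"
    and "dropWhile (\<lambda>a. a \<noteq> u) (A @ u # B @ [neg u]) = u # B @ [neg u]"
    by (auto simp: takeWhile_append2 dropWhile_append2)
  then show ?thesis
    by (simp add: flip_def reg_decomp_def vwalk_join_def)
qed

text \<open>The segment \<open>u # B @ [neg u]\<close> contraposes to a walk with the same two ends,
  so it can be glued back onto \<open>A\<close>; the variables of \<open>B\<close> are merely
  reversed.\<close>

lemma flip_in_nr_paths:
  assumes "P \<in> nr_paths (idg F) x"
  shows "flip P \<in> nr_paths (idg F) x"
proof -
  obtain A u B where P: "P = A @ u # B @ [neg u]" and d: "distinct (map var (A @ u # B))"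
    and w: "vwalk P (idg F)" and h: "hd P = x"
    using assms by (rule nr_pathsE)
  have "vwalk ((A @ [u]) @ B @ [neg u]) (idg F)" "vwalk (A @ u # B @ [neg u]) (idg F)"
    using w by (simp_all add: P)
  then have "vwalk (A @ [u]) (idg F)" "vwalk (u # B @ [neg u]) (idg F)"
    by (blast intro: vwalkI_append_l vwalkI_append_r)+
  then have "vwalk (A @ [u]) (idg F)" "vwalk (u # contrapos B @ [neg u]) (idg F)"
    using vwalk_contrapos[of "u # B @ [neg u]" F] by auto
  then have "vwalk (A @ u # contrapos B @ [neg u]) (idg F)"
    by (cases "A = []") (auto simp: vwalk_append_iff)
  moreover have "hd (A @ u # contrapos B @ [neg u]) = x"
    using h by (cases A) (auto simp: P)
  moreover have "distinct (map var (A @ u # contrapos B))"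
    using d by auto
  ultimately show ?thesis
    unfolding nr_paths_iff P flip_form[OF d] by blast
qed

lemma flip_flip:
  assumes "P \<in> nr_paths G x"
  shows "flip (flip P) = P"
proof -
  obtain A u B where "P = A @ u # B @ [neg u]" and d: "distinct (map var (A @ u # B))"
    using assms by (rule nr_pathsE)
  moreover have "distinct (map var (A @ u # contrapos B))"
    using d by auto
  ultimately show ?thesis
    by (simp only: flip_form contrapos_contrapos)
qed

text \<open>Cutting at \<open>u\<close> separates the clauses of the stem, which a flip leaves
  alone, from those of the cycle.\<close>

lemma path_clauses_append:
  "path_clauses (A @ u # R) = path_clauses (A @ [u]) \<union> arc_clauses (set (vwalk_arcs (u # R)))"
proof -
  have "set (vwalk_arcs (A @ u # R)) = set (vwalk_arcs (A @ [u])) \<union> set (vwalk_arcs (u # R))"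
    by (cases "A = []") (auto simp: vwalk_arcs_append)
  moreover have "hd (A @ u # R) = hd (A @ [u])" by (cases A) auto
  ultimately show ?thesis
    by (auto simp: path_clauses_def arc_clauses_Un)
qed

lemma path_clauses_flip:
  assumes "P \<in> nr_paths G x"
  shows "path_clauses (flip P) = path_clauses P"
proof -
  obtain A u B where P: "P = A @ u # B @ [neg u]" and d: "distinct (map var (A @ u # B))"
    using assms by (rule nr_pathsE)
  have "contrapos (u # B @ [neg u]) = u # contrapos B @ [neg u]"
    by simp
  then show ?thesis
    unfolding P flip_form[OF d] path_clauses_append[of A u "B @ [neg u]"]
      path_clauses_append[of A u "contrapos B @ [neg u]"]
    by (metis arc_clauses_vwalk_arcs_contrapos)
qed

text \<open>Both sides amount to \<open>B = []\<close>: only then does \<open>u\<close> directly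
  precede \<open>neg u\<close>, and a nonempty \<open>B\<close> equal to its contraposition would
  contain a complementary pair. Hence the output test asks whether \<open>P\<close> is the least of
  \<open>P\<close> and \<open>flip P\<close>.\<close>

lemma is_unit_arc_iff_flip:
  assumes "P \<in> nr_paths G x"
  shows "is_unit_arc (last (vwalk_arcs P)) \<longleftrightarrow> flip P = P"
proof -
  obtain A u B where P: "P = A @ u # B @ [neg u]" and d: "distinct (map var (A @ u # B))"
    using assms by (rule nr_pathsE)
  have "vwalk_arcs ((A @ u # B) @ [neg u]) = vwalk_arcs (A @ u # B) @ [(last (A @ u # B), neg u)]"
    by (subst vwalk_arcs_append) auto
  then have "is_unit_arc (last (vwalk_arcs P)) \<longleftrightarrow> last (u # B) = u"
    by (auto simp: P is_unit_arc_def)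
  also have "\<dots> \<longleftrightarrow> B = []"
    using d last_in_set[of B] by auto
  also have "\<dots> \<longleftrightarrow> contrapos B = B"
  proof
    assume *: "contrapos B = B"
    show "B = []"
    proof (rule ccontr)
      assume "B \<noteq> []"
      then obtain b where b: "b \<in> set B" by (cases B) auto
      then have "neg b \<in> set B"
        using * set_contrapos[of B] by force
      then show False
        using b d distinct_map_var_neg[of B b] by auto
    qed
  qed simp
  finally show ?thesis
    unfolding P flip_form[OF d] by simp
qed

section \<open>Paths and minimally unsatisfiable sets\<close>

text \<open>The arc from \<open>neg (hd P)\<close> to \<open>hd P\<close> contributes the unit-clause.\<close>

lemma path_clauses_eq:
  assumes "P \<noteq> []"
  shows "path_clauses P = arc_clauses (set (vwalk_arcs (neg (hd P) # P)))"
  using assms by (simp add: path_clauses_def arc_clauses_insert)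

lemma path_clauses_subset:
  assumes "vwalk P (idg F)" "{hd P} \<in> F"
  shows "path_clauses P \<subseteq> F"
  using assms by (auto simp: path_clauses_def arc_clauses_subset_iff vwalk_def)

text \<open>The unit-clause makes the first vertex true, and each arc clause is an implication that
  passes truth on to the next vertex.\<close>

lemma path_clauses_true:
  assumes "\<And>C. C \<in> path_clauses P \<Longrightarrow> \<exists>a\<in>C. lit_true \<phi> a" and "b \<in> set P"
  shows "lit_true \<phi> b"
proof -
  have "\<lbrakk>lit_true \<phi> (hd P); \<forall>(a, b)\<in>set (vwalk_arcs P). lit_true \<phi> a \<longrightarrow> lit_true \<phi> b\<rbrakk>
      \<Longrightarrow> \<forall>b\<in>set P. lit_true \<phi> b" for P
    by (induction P rule: vwalk_arcs.induct) auto
  moreover have "lit_true \<phi> (hd P)"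
    using assms(1)[of "{hd P}"] by (simp add: path_clauses_def)
  moreover have "lit_true \<phi> a \<longrightarrow> lit_true \<phi> b" if "(a, b) \<in> set (vwalk_arcs P)" for a b
    using assms(1)[of "{neg a, b}"] that by (auto simp: path_clauses_def arc_clauses_def)
  ultimately show ?thesis
    using assms(2) by blast
qed

lemma unsatisfiable_path_clauses:
  assumes "P \<in> nr_paths G x"
  shows "\<not> satisfiable (path_clauses P)"
proof
  obtain A u B where P: "P = A @ u # B @ [neg u]"
    using assms by (rule nr_pathsE)
  assume "satisfiable (path_clauses P)"
  then obtain \<phi> where "\<And>b. b \<in> set P \<Longrightarrow> lit_true \<phi> b"
    unfolding satisfiable_def using path_clauses_true by meson
  from this[of u] this[of "neg u"] have "lit_true \<phi> u" "lit_true \<phi> (neg u)"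
    by (simp_all add: P)
  then show False by simp
qed

text \<open>
  To satisfy all clauses except the one of the arc \<open>(a, b)\<close>, make the literals up to \<open>a\<close> true and
  those from \<open>b\<close> on false.
\<close>

lemma min_unsat_path_clauses:
  assumes "P \<in> nr_paths G x"
  shows "min_unsat (path_clauses P)"
  unfolding min_unsat_def
proof (intro conjI ballI)
  show "\<not> satisfiable (path_clauses P)"
    using assms by (rule unsatisfiable_path_clauses)
next
  fix C assume C: "C \<in> path_clauses P"
  obtain A u B where P: "P = A @ u # B @ [neg u]" and d: "distinct (map var (A @ u # B))"
    using assms by (rule nr_pathsE)
  define E where "E = neg (hd P) # P"
  have clauses: "path_clauses P = arc_clauses (set (vwalk_arcs E))"
    unfolding E_def by (rule path_clauses_eq) (simp add: P)
  obtain a b where "(a, b) \<in> set (vwalk_arcs E)" and Cab: "C = {neg a, b}"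
    using C clauses by (auto simp: arc_clauses_def)
  then obtain X Y where E: "E = (X @ [a]) @ (b # Y)"
    by (auto simp: set_vwalk_arcs)
  \<comment> \<open>\<open>tl\<close> discards the added vertex \<open>neg (hd P)\<close> and
    \<open>butlast\<close> the final \<open>neg u\<close>. The remaining vertices form
    \<open>A @ u # B\<close>, whose distinct variables make \<open>T\<close> consistent.\<close>
  define T where "T = set (tl (X @ [a])) \<union> neg ` set (butlast (b # Y))"
  have "tl (X @ [a]) @ butlast (b # Y) = butlast (tl E)"
    unfolding E by (cases X) (simp_all add: butlast_append)
  also have "\<dots> = A @ u # B"
    by (simp add: E_def P butlast_append)
  finally have "distinct (map var (tl (X @ [a]) @ butlast (b # Y)))"
    using d by simp
  then have "distinct (map var (tl (X @ [a]) @ map neg (butlast (b # Y))))"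
    by (simp add: comp_def)
  moreover have "T = set (tl (X @ [a]) @ map neg (butlast (b # Y)))"
    unfolding T_def by (simp only: set_append set_map)
  ultimately have "neg l \<notin> T" if "l \<in> T" for l
    using that distinct_map_var_neg by metis
  then obtain \<phi> where \<phi>: "\<And>l. l \<in> T \<Longrightarrow> lit_true \<phi> l"
    using ex_override[of T] by metis
  have "\<exists>l\<in>D. l \<in> T" if "D \<in> path_clauses P - {C}" for D
  proof -
    have "D \<in> arc_clauses (set (vwalk_arcs E))"
      using that clauses by simp
    then obtain p q where pq: "(p, q) \<in> set (vwalk_arcs E)" "D = {neg p, q}"
      unfolding arc_clauses_def by blast
    have "(p, q) \<noteq> (a, b)"
      using that Cab pq by auto
    \<comment> \<open>An arc other than \<open>(a, b)\<close> lies wholly on one side of the cut.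
      Its clause is satisfied by its head before the cut and by its negated tail after it.\<close>
    then consider "(p, q) \<in> set (vwalk_arcs (X @ [a]))" | "(p, q) \<in> set (vwalk_arcs (b # Y))"
      using pq(1) unfolding E by (subst (asm) vwalk_arcs_append) auto
    then show ?thesis
    proof cases
      case 1
      then obtain us vs where "X @ [a] = us @ p # q # vs"
        by (auto simp: set_vwalk_arcs)
      then have "q \<in> set (tl (X @ [a]))" by (cases us) auto
      then show ?thesis by (auto simp: T_def pq)
    next
      case 2
      then obtain us vs where "b # Y = us @ p # q # vs"
        by (auto simp: set_vwalk_arcs)
      then have "p \<in> set (butlast (b # Y))" by (simp add: butlast_append)
      then have "neg p \<in> T" unfolding T_def by blast
      then show ?thesis by (auto simp: pq)
    qed
  qed
  then show "satisfiable (path_clauses P - {C})"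
    unfolding satisfiable_def using \<phi> by meson
qed

text \<open>The shortest irregular prefix works: its last vertex completes the first complementary
  pair. The induction strips vertices from the end until the rest is regular.\<close>

lemma nr_prefix_exists:
  assumes "vpath p G" "hd p = x" "\<not> regular p"
  shows "\<exists>P \<in> nr_paths G x. prefix P p"
  using assms
proof (induction p rule: rev_induct)
  case (snoc w p)
  show ?case
  proof (cases "regular p")
    case True
    have d: "distinct (p @ [w])" using snoc.prems by auto
    have "distinct (map var p)"
      using d True by (simp add: distinct_map_var_iff)
    obtain a where a: "a \<in> set (p @ [w])" "neg a \<in> set (p @ [w])"
      using snoc.prems(3) by (auto simp: regular_def compl_pairs_def)
    moreover have "\<not> (a \<in> set p \<and> neg a \<in> set p)"
      using True by (auto simp: regular_def compl_pairs_def)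
    ultimately have "neg w \<in> set p" by auto
    then obtain A B where "p = A @ neg w # B" by (metis split_list)
    then have "p @ [w] \<in> nr_paths G x"
      using snoc.prems \<open>distinct (map var p)\<close> unfolding nr_paths_iff
      by (intro conjI exI[of _ A] exI[of _ "neg w"] exI[of _ B]) (auto simp: vpath_def)
    then show ?thesis by blast
  next
    case False
    then have "p \<noteq> []" by (auto simp: regular_def compl_pairs_def)
    moreover have "vpath p G"
      using snoc.prems(1) \<open>p \<noteq> []\<close> vwalkI_append_l by (auto simp: vpath_def)
    ultimately have "\<exists>P \<in> nr_paths G x. prefix P p"
      using snoc.IH snoc.prems False by (cases p) auto
    then show ?thesis by auto
  qed
qed (simp add: regular_def compl_pairs_def)

lemma reachable_neg_imp_nr_path:
  assumes "x \<rightarrow>\<^sup>*\<^bsub>idg F\<^esub> neg x"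
  shows "\<exists>P. P \<in> nr_paths (idg F) x"
proof -
  interpret wf_digraph "idg F" by (rule wf_digraph_idg)
  obtain q where q: "vpath q (idg F)" "hd q = x" "last q = neg x"
    using assms by (metis reachable_vwalk_conv vwalk_imp_ex_vpath)
  then have "q \<noteq> []" by auto
  then have "x \<in> set q" "neg x \<in> set q"
    using q by (metis hd_in_set, metis last_in_set)
  then have "\<not> regular q"
    by (auto simp: regular_def compl_pairs_def)
  then show ?thesis
    using nr_prefix_exists q by blast
qed

lemma reachable_contrapos:
  assumes "a \<rightarrow>\<^sup>*\<^bsub>idg F\<^esub> b"
  shows "neg b \<rightarrow>\<^sup>*\<^bsub>idg F\<^esub> neg a"
proof -
  interpret wf_digraph "idg F" by (rule wf_digraph_idg)
  obtain p where "vwalk p (idg F)" "hd p = a" "last p = b"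
    using assms by (metis reachable_vwalk_conv)
  then show ?thesis
    unfolding reachable_vwalk_conv
    by (intro exI[of _ "contrapos p"]) (auto simp: vwalk_contrapos hd_contrapos last_contrapos)
qed

text \<open>The case \<open>b = a\<close> covers unit-clauses, matching their encoding as
  \<open>{a, a}\<close> in \<open>idg\<close>.\<close>

lemma card_1_or_2E:
  assumes "card C = 1 \<or> card C = 2" "a \<in> C"
  obtains b where "C = {a, b}"
proof -
  have "finite C" using assms(1) card.infinite by fastforce
  then have "card (C - {a}) = 0 \<or> card (C - {a}) = 1"
    using assms by auto
  then consider "C - {a} = {}" | b where "C - {a} = {b}"
    using \<open>finite C\<close> by (auto simp: card_1_singleton_iff)
  then show ?thesis
  proof cases
    case 1
    then have "C = {a, a}" using assms(2) by auto
    then show ?thesis by (rule that)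
  next
    case 2
    then have "C = {a, b}" using assms(2) by auto
    then show ?thesis by (rule that)
  qed
qed

text \<open>
  If the literals reachable from \<open>x\<close> contained no complementary pair, then making them true in an
  assignment satisfying all clauses but \<open>{x}\<close> would satisfy \<open>F\<close>.
\<close>

lemma min_unsat_imp_nr_path:
  assumes mu: "min_unsat F" and x: "{x} \<in> F" and sz: "\<forall>C\<in>F. card C = 1 \<or> card C = 2"
  shows "\<exists>P. P \<in> nr_paths (idg F) x"
proof -
  interpret wf_digraph "idg F" by (rule wf_digraph_idg)
  define S where "S = {a. x \<rightarrow>\<^sup>*\<^bsub>idg F\<^esub> a}"
  have "\<exists>a. a \<in> S \<and> neg a \<in> S"
  proof (rule ccontr)
    assume "\<not> ?thesis"
    then have cons: "\<And>a. a \<in> S \<Longrightarrow> neg a \<notin> S" by blast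
    have "satisfiable (F - {{x}})"
      using mu x by (simp add: min_unsat_def)
    then obtain \<phi> where \<phi>: "\<And>C. C \<in> F - {{x}} \<Longrightarrow> \<exists>a\<in>C. lit_true \<phi> a"
      unfolding satisfiable_def by meson
    obtain \<psi> where \<psi>: "\<And>a. lit_true \<psi> a \<longleftrightarrow> a \<in> S \<or> neg a \<notin> S \<and> lit_true \<phi> a"
      using ex_override[of S \<phi>] cons by metis
    have "x \<in> lits F"
      using x by (auto simp: lits_def)
    then have "x \<in> S" by (simp add: S_def)
    have "\<exists>a\<in>C. lit_true \<psi> a" if C: "C \<in> F" for C
    proof (cases "\<exists>a\<in>C. neg a \<in> S")
      case True
      then obtain a where a: "a \<in> C" "neg a \<in> S" by blast
      then obtain b where b: "C = {a, b}"
        using sz C card_1_or_2E by metis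
      then have "(neg a, b) \<in> arcs_ends (idg F)"
        using C by simp
      then have "b \<in> S"
        using a(2) unfolding S_def by (auto intro: reachable_adj_trans)
      then show ?thesis by (auto simp: b \<psi>)
    next
      case False
      show ?thesis
      proof (cases "C = {x}")
        case True
        then show ?thesis using \<open>x \<in> S\<close> by (simp add: \<psi>)
      next
        case 2: False
        then show ?thesis using \<phi>[of C] C False by (auto simp: \<psi>)
      qed
    qed
    then have "satisfiable F" unfolding satisfiable_def by blast
    then show False using mu by (simp add: min_unsat_def)
  qed
  then obtain a where "x \<rightarrow>\<^sup>*\<^bsub>idg F\<^esub> a" "x \<rightarrow>\<^sup>*\<^bsub>idg F\<^esub> neg a"
    unfolding S_def by blast
  \<comment> \<open>The walk from \<open>x\<close> to \<open>neg a\<close> contraposes to one from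
    \<open>a\<close> to \<open>neg x\<close>, which continues the walk from \<open>x\<close> to
    \<open>a\<close>.\<close>
  then have "x \<rightarrow>\<^sup>*\<^bsub>idg F\<^esub> neg x"
    using reachable_contrapos[of F x "neg a"] by (auto intro: reachable_trans)
  then show ?thesis
    by (rule reachable_neg_imp_nr_path)
qed

lemma lits_mono: "F' \<subseteq> F \<Longrightarrow> lits F' \<subseteq> lits F"
  by (auto simp: lits_def)

lemma nr_paths_idg_mono:
  assumes "F' \<subseteq> F"
  shows "nr_paths (idg F') x \<subseteq> nr_paths (idg F) x"
proof -
  have "arcs_ends (idg F') \<subseteq> arcs_ends (idg F)"
    using assms by auto
  then have "vwalk P (idg F') \<Longrightarrow> vwalk P (idg F)" for P
    using lits_mono[OF assms] by (auto simp: vwalk_def)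
  then show ?thesis
    unfolding nr_paths_iff subset_iff by blast
qed

text \<open>For a minimally unsatisfiable \<open>F'\<close>, a path found in \<open>idg F'\<close>
  has an unsatisfiable set of clauses inside \<open>F'\<close>, which by minimality is all of
  \<open>F'\<close>; the path also lies in the larger digraph \<open>idg F\<close>.\<close>

lemma mus_containing_eq:
  assumes x: "{x} \<in> F" and sz: "\<forall>C\<in>F. card C = 1 \<or> card C = 2"
  shows "mus_containing {x} F = path_clauses ` nr_paths (idg F) x"
proof
  show "path_clauses ` nr_paths (idg F) x \<subseteq> mus_containing {x} F"
  proof
    fix F' assume "F' \<in> path_clauses ` nr_paths (idg F) x"
    then obtain P where P: "P \<in> nr_paths (idg F) x" "F' = path_clauses P" by blast
    then have "path_clauses P \<subseteq> F"
      using x by (intro path_clauses_subset) (auto simp: nr_paths_iff)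
    moreover have "{x} \<in> path_clauses P"
      using P by (auto simp: path_clauses_def nr_paths_iff)
    ultimately show "F' \<in> mus_containing {x} F"
      using P min_unsat_path_clauses by (auto simp: mus_containing_def)
  qed
  show "mus_containing {x} F \<subseteq> path_clauses ` nr_paths (idg F) x"
  proof
    fix F' assume "F' \<in> mus_containing {x} F"
    then have F': "F' \<subseteq> F" "min_unsat F'" "{x} \<in> F'"
      by (auto simp: mus_containing_def)
    then obtain P where P: "P \<in> nr_paths (idg F') x"
      using min_unsat_imp_nr_path[of F' x] sz by blast
    have sub: "path_clauses P \<subseteq> F'"
      using P F'(3) by (intro path_clauses_subset) (auto simp: nr_paths_iff)
    have "F' \<subseteq> path_clauses P"
    proof
      fix C assume "C \<in> F'"
      show "C \<in> path_clauses P"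
      proof (rule ccontr)
        assume "C \<notin> path_clauses P"
        then have "path_clauses P \<subseteq> F' - {C}" using sub by blast
        moreover have "satisfiable (F' - {C})"
          using F'(2) \<open>C \<in> F'\<close> by (simp add: min_unsat_def)
        ultimately have "satisfiable (path_clauses P)"
          unfolding satisfiable_def by (meson subsetD)
        then show False using unsatisfiable_path_clauses[OF P] by blast
      qed
    qed
    then show "F' \<in> path_clauses ` nr_paths (idg F) x"
      using sub P nr_paths_idg_mono[OF F'(1)] by blast
  qed
qed

section \<open>Nearly regular paths with the same clauses\<close>

lemma nr_path_not_subset_regular:
  assumes "P \<in> nr_paths G x" "regular C"
  shows "\<not> set P \<subseteq> set C"
proof -
  have "compl_pairs P \<noteq> {}"
    using assms(1) by (auto simp: nr_paths_def nearly_regular_def)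
  then show ?thesis
    using assms(2) unfolding regular_def compl_pairs_def by blast
qed

text \<open>A proper prefix of \<open>Q\<close> lies within the regular list
  \<open>butlast Q\<close>, so it has no complementary pair. Hence two different paths are always
  told apart by a first differing literal.\<close>

lemma nr_path_prefix_eq:
  assumes "P \<in> nr_paths G x" "Q \<in> nr_paths G x" "prefix P Q"
  shows "P = Q"
proof (rule ccontr)
  assume "P \<noteq> Q"
  then have "prefix P (butlast Q)"
    using assms(3) by (metis append_butlast_last_id prefix_Nil prefix_snoc)
  then have "set P \<subseteq> set (butlast Q)"
    by (rule set_mono_prefix)
  moreover have "regular (butlast Q)"
    using assms(2) by (simp add: nr_paths_def nearly_regular_def)
  ultimately show False
    using nr_path_not_subset_regular[OF assms(1)] by blast
qed

lemma nr_paths_diff: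
  assumes "P \<in> nr_paths G x" "Q \<in> nr_paths G x" "P \<noteq> Q"
  obtains C a b P' Q' where "P = C @ a # P'" "Q = C @ b # Q'" "a \<noteq> b" "C \<noteq> []"
proof -
  have "P \<parallel> Q"
    using assms nr_path_prefix_eq by (metis parallelI)
  then obtain C a b P' Q' where *: "a \<noteq> b" "P = C @ a # P'" "Q = C @ b # Q'"
    using parallel_decomp by metis
  moreover have "hd P = hd Q"
    using assms by (simp add: nr_paths_iff)
  with * have "C \<noteq> []" by auto
  ultimately show ?thesis using that by blast
qed

text \<open>Let \<open>Q\<close> leave the common part by the arc \<open>(c, b)\<close>. Its clause
  occurs in \<open>P\<close>, but not through the same arc, so \<open>P\<close> has the
  contrapositive arc \<open>(neg b, neg c)\<close>. As \<open>c\<close> already lies on the regular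
  part of \<open>P\<close>, \<open>neg c\<close> must be its last vertex; so \<open>c = u\<close>,
  and \<open>neg b\<close> is the vertex before \<open>neg u\<close>.\<close>

lemma nr_path_branch:
  assumes P: "A @ u # B @ [neg u] \<in> nr_paths G x" and d: "distinct (map var (A @ u # B))"
    and Q: "Q \<in> nr_paths G x"
    and sub: "path_clauses Q \<subseteq> path_clauses (A @ u # B @ [neg u])"
    and neq: "Q \<noteq> A @ u # B @ [neg u]"
  shows "B \<noteq> [] \<and> (\<exists>R. Q = A @ u # neg (last B) # R)"
proof -
  let ?P = "A @ u # B @ [neg u]"
  obtain C a b P' Q' where eqs: "?P = C @ a # P'" "Q = C @ b # Q'" "a \<noteq> b" "C \<noteq> []"
    using nr_paths_diff[OF P Q] neq by metis
  define c where "c = last C"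
  obtain C' where C: "C = C' @ [c]"
    using eqs(4) c_def by (metis append_butlast_last_id)
  have P_eq: "?P = C' @ c # a # P'" and Q_eq: "Q = C' @ c # b # Q'"
    using eqs C by auto
  have dP: "distinct ?P" and dQ: "distinct Q" and hd: "hd Q = x" "hd ?P = x"
    using P Q by (simp_all only: nr_paths_def vpath_def mem_Collect_eq)
  have "(c, b) \<in> set (vwalk_arcs Q)"
    using Q_eq by (auto simp: set_vwalk_arcs)
  then have "{neg c, b} \<in> path_clauses ?P"
    using sub by (auto simp: path_clauses_def arc_clauses_def)
  \<comment> \<open>This rules out that the clause of the arc \<open>(c, b)\<close> is the
    unit-clause \<open>{x}\<close> contributed by the start of the path.\<close>
  moreover have "b \<noteq> x"
    using dQ hd(1) Q_eq by (cases C') auto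
  ultimately obtain e f where ef: "(e, f) \<in> set (vwalk_arcs ?P)" "{neg c, b} = {neg e, f}"
    using hd(2) by (auto simp: path_clauses_def arc_clauses_def)
  obtain X Y where X: "?P = X @ e # f # Y"
    using ef(1) set_vwalk_arcs by metis
  have "\<not> (c = e \<and> b = f)"
  proof
    assume "c = e \<and> b = f"
    then have "?P = X @ c # b # Y"
      using X by simp
    moreover from this have "c \<notin> set X" "c \<notin> set (b # Y)"
      using dP by simp_all
    ultimately have "b # Y = a # P'"
      using P_eq append_Cons_eq_iff[of c X "b # Y" C' "a # P'"] by simp
    then have "b = a" by simp
    then show False using eqs(3) by simp
  qed
  then have ef': "f = neg c" "b = neg e"
    using ef(2) by (auto simp: doubleton_eq_iff)
  have "butlast ?P = A @ u # B"
    by (simp add: butlast_append)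
  moreover have "c \<in> set (butlast ?P)"
    unfolding P_eq by (simp add: butlast_append)
  ultimately have c: "c \<in> set (A @ u # B)" by metis
  have "neg c \<notin> set (A @ u # B)"
    using c d unfolding distinct_map_var_iff regular_def compl_pairs_def by blast
  moreover have "A @ u # B = X @ e # neg c # butlast Y" if "Y \<noteq> []"
    using that \<open>butlast ?P = _\<close> unfolding X ef'(1) by (simp add: butlast_append)
  ultimately have "Y = []"
    by (metis in_set_conv_decomp append_Cons append_assoc append_Nil)
  then have "A @ u # B = X @ [e]" "f = neg u"
    using X by (metis append.assoc append_Cons append_Nil append_butlast_last_id
        butlast_snoc last_snoc not_Cons_self2 snoc_eq_iff_butlast)+
  then have "c = u" "e = last (u # B)"
    using ef' by (auto dest: arg_cong[of _ _ last] split: if_splits)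
  then have "A = C'"  "a # P' = B @ [neg u]"
    using P_eq dP by (auto simp: append_eq_append_conv2 append_eq_Cons_conv Cons_eq_append_conv)
  \<comment> \<open>For empty \<open>B\<close>, the diverging vertices \<open>a\<close> and
    \<open>b\<close> would both be \<open>neg u\<close>.\<close>
  then have "B \<noteq> []"
    using eqs(3) ef' \<open>e = _\<close> by auto
  then show ?thesis
    using Q_eq \<open>A = C'\<close> \<open>c = u\<close> ef' \<open>e = _\<close> by auto
qed

text \<open>If \<open>Q\<close> differed from both \<open>P\<close> and \<open>flip P\<close>,
  branching off each of them would make the vertex after \<open>u\<close> equal to both
  \<open>neg (last B)\<close> and \<open>hd B\<close>, which the distinct variables of
  \<open>B\<close> forbid.\<close>

lemma path_clauses_subset_cases:
  assumes P: "P \<in> nr_paths (idg F) x" and Q: "Q \<in> nr_paths (idg F) x"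
    and sub: "path_clauses Q \<subseteq> path_clauses P"
  shows "Q = P \<or> Q = flip P"
proof (rule ccontr)
  assume neq: "\<not> ?thesis"
  obtain A u B where P_eq: "P = A @ u # B @ [neg u]" and d: "distinct (map var (A @ u # B))"
    using P by (rule nr_pathsE)
  note flip = flip_form[OF d]
  have d': "distinct (map var (A @ u # contrapos B))"
    using d by auto
  obtain R where B: "B \<noteq> []" and R: "Q = A @ u # neg (last B) # R"
    using nr_path_branch[of A u B] P Q sub neq d unfolding P_eq by blast
  obtain R' where "Q = A @ u # neg (last (contrapos B)) # R'"
    using nr_path_branch[of A u "contrapos B" "idg F" x Q] flip_in_nr_paths[OF P] Q sub neq d'
      path_clauses_flip[OF P] unfolding P_eq flip by blast
  then have "hd B = neg (last B)"
    using R B by (simp add: last_contrapos)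
  then show False
    using d B by (metis distinct_map_var_iff distinct_append map_append set_ConsD hd_in_set
      inj_on_eq_iff distinct_map last_in_set neg_neq(1) var_neg distinct.simps(2) list.simps(9))
qed

section \<open>The pathlex order\<close>

lemma path_less_irrefl: "\<not> path_less L P P"
  by (simp add: path_less_def lexord_irreflexive)

lemma path_less_trans:
  assumes "linear_order_on A L" "path_less L P Q" "path_less L Q R"
  shows "path_less L P R"
proof -
  have "trans (L - Id)"
    using assms(1) by (auto simp: order_on_defs intro: trans_diff_Id)
  then show ?thesis
    using assms(2,3) unfolding path_less_def by (rule lexord_trans[rotated 2])
qed

lemma path_less_append: "(a, b) \<in> L - Id \<Longrightarrow> path_less L (C @ a # P) (C @ b # Q)"
  unfolding path_less_def by (rule lexord_append_leftI) simp

lemma path_less_total: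
  assumes "linear_order_on (verts G) L" "P \<in> nr_paths G x" "Q \<in> nr_paths G x" "P \<noteq> Q"
  shows "path_less L P Q \<or> path_less L Q P"
proof -
  obtain C a b P' Q' where *: "P = C @ a # P'" "Q = C @ b # Q'" "a \<noteq> b" "C \<noteq> []"
    using nr_paths_diff assms by metis
  have "a \<in> verts G" "b \<in> verts G"
    using assms(2,3) * by (auto simp: nr_paths_iff vwalk_def)
  then have "(a, b) \<in> L - Id \<or> (b, a) \<in> L - Id"
    using assms(1) *(3) by (auto simp: order_on_defs total_on_def)
  then show ?thesis
    using path_less_append * by metis
qed

text \<open>Only \<open>P\<close> and \<open>flip P\<close> have these clauses, so comparing the two
  decides which is first. Another least path would be \<open>flip P\<close>, giving \<open>P\<close>
  below itself.\<close>

lemma first_path_eq: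
  assumes L: "linear_order_on A L" and P: "P \<in> nr_paths (idg F) x"
    and less: "flip P = P \<or> path_less L P (flip P)"
  shows "first_path F L x (path_clauses P) = P"
  unfolding first_path_def
proof (rule the_equality)
  show "P \<in> nr_paths (idg F) x \<and> path_clauses P = path_clauses P \<and>
     (\<forall>Q\<in>nr_paths (idg F) x. path_clauses Q = path_clauses P \<and> Q \<noteq> P \<longrightarrow> path_less L P Q)"
    using P less path_clauses_subset_cases by blast
  show "R = P" if "R \<in> nr_paths (idg F) x \<and> path_clauses R = path_clauses P \<and>
     (\<forall>Q\<in>nr_paths (idg F) x. path_clauses Q = path_clauses P \<and> Q \<noteq> R \<longrightarrow> path_less L R Q)" for R
  proof (rule ccontr)
    assume "R \<noteq> P"
    then have "path_less L R P" "R = flip P"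
      using that P path_clauses_subset_cases[OF P, of R] by auto
    then have "path_less L P P"
      using less \<open>R \<noteq> P\<close> path_less_trans[OF L] by metis
    then show False by (simp add: path_less_irrefl)
  qed
qed

section \<open>The enumeration\<close>

lemma sorted_wrt_strict_unique:
  assumes "\<And>a b. R a b \<Longrightarrow> \<not> R b a"
  shows "\<lbrakk>sorted_wrt R xs; sorted_wrt R ys; set xs = set ys\<rbrakk> \<Longrightarrow> xs = ys"
proof (induction xs arbitrary: ys)
  case (Cons a xs)
  then obtain b ys' where ys: "ys = b # ys'" by (cases ys) auto
  have eq: "a = b"
  proof (rule ccontr)
    assume "a \<noteq> b"
    then have "a \<in> set ys'" "b \<in> set xs"
      using Cons.prems(3) unfolding ys by auto
    then show False
      using Cons.prems(1,2) assms unfolding ys by auto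
  qed
  have "a \<notin> set xs" "b \<notin> set ys'"
    using Cons.prems(1,2) assms unfolding ys by auto
  then have "set xs = set ys'"
    using Cons.prems(3) eq unfolding ys by auto
  then show ?case
    using Cons eq unfolding ys by auto
qed simp

lemma sorted_wrt_conj: "sorted_wrt (\<lambda>a b. R a b \<and> S a b) xs \<longleftrightarrow> sorted_wrt R xs \<and> sorted_wrt S xs"
  by (induction xs) auto

lemma sorted_wrt_neq: "sorted_wrt (\<noteq>) xs \<longleftrightarrow> distinct xs"
  by (induction xs) auto

lemma sorted_wrt_imp_distinct: "\<lbrakk>sorted_wrt R xs; \<And>a. \<not> R a a\<rbrakk> \<Longrightarrow> distinct xs"
  by (induction xs) auto

lemma ex_sorted_wrt:
  assumes "finite A" and "\<And>a b c. \<lbrakk>R a b; R b c\<rbrakk> \<Longrightarrow> R a c"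
    and "\<And>a b. \<lbrakk>a \<in> A; b \<in> A; a \<noteq> b\<rbrakk> \<Longrightarrow> R a b \<or> R b a"
  shows "\<exists>zs. set zs = A \<and> sorted_wrt R zs"
  using assms(1,3)
proof (induction A rule: finite_induct)
  case (insert a A)
  then obtain zs where zs: "set zs = A" "sorted_wrt R zs" by auto
  define ls rs where "ls = filter (\<lambda>b. R b a) zs" and "rs = filter (\<lambda>b. \<not> R b a) zs"
  have ls: "\<forall>b\<in>set ls. R b a"
    by (simp add: ls_def)
  have rs: "\<forall>c\<in>set rs. R a c"
    using insert.prems[of a] insert.hyps(2) zs(1) by (auto simp: rs_def)
  have "\<forall>b\<in>set ls. \<forall>c\<in>set rs. R b c"
    using ls rs assms(2) by blast
  moreover have "sorted_wrt R ls" "sorted_wrt R rs"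
    using zs(2) by (simp_all add: ls_def rs_def sorted_wrt_filter)
  ultimately have "sorted_wrt R (ls @ a # rs)"
    using ls rs by (simp add: sorted_wrt_append)
  moreover have "set (ls @ a # rs) = insert a A"
    using zs(1) by (auto simp: ls_def rs_def)
  ultimately show ?case by blast
qed simp

text \<open>Passing to \<open>L - Id\<close> turns distinct and sorted into one strict sortedness
  condition; existence and uniqueness for it evaluate the description in
  \<open>listing\<close>.\<close>

lemma listing_strict:
  assumes L: "linear_order_on A L" and "finite A"
  shows "set (listing L A) = A \<and> sorted_wrt (\<lambda>a b. (a, b) \<in> L - Id) (listing L A)"
proof -
  let ?R = "\<lambda>a b. (a, b) \<in> L - Id"
  have tr: "trans (L - Id)" and as: "\<And>a b. ?R a b \<Longrightarrow> \<not> ?R b a"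
    and tot: "\<And>a b. \<lbrakk>a \<in> A; b \<in> A; a \<noteq> b\<rbrakk> \<Longrightarrow> ?R a b \<or> ?R b a"
    using L by (auto simp: order_on_defs total_on_def antisym_def intro: trans_diff_Id)
  have strict: "distinct zs \<and> sorted_wrt (\<lambda>a b. (a, b) \<in> L) zs \<longleftrightarrow> sorted_wrt ?R zs" for zs
    by (simp add: sorted_wrt_conj sorted_wrt_neq conj_commute)
  obtain zs where zs: "set zs = A" "sorted_wrt ?R zs"
    using ex_sorted_wrt[OF assms(2), of ?R] tot transD[OF tr] by metis
  have "listing L A = zs"
    unfolding listing_def strict
    by (rule the_equality) (use zs sorted_wrt_strict_unique[of ?R, OF as] in auto)
  then show ?thesis using zs by simp
qed

lemma sorted_wrt_concat_map:
  assumes "\<And>z. z \<in> set zs \<Longrightarrow> sorted_wrt R (f z)"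
    and "sorted_wrt (\<lambda>z z'. \<forall>p\<in>set (f z). \<forall>q\<in>set (f z'). R p q) zs"
  shows "sorted_wrt R (concat (map f zs))"
  using assms
proof (induction zs)
  case (Cons z zs)
  then have "sorted_wrt R (concat (map f zs))" by simp
  then show ?case
    using Cons.prems by (simp add: sorted_wrt_append)
qed simp

section \<open>Completeness and order of the search\<close>

lemma vwalk_induce_subgraph:
  assumes "vwalk p G" "set p \<subseteq> S"
  shows "vwalk p (G \<restriction> S)"
proof
  show "set p \<subseteq> verts (G \<restriction> S)" "p \<noteq> []"
    using assms by (auto simp: vwalk_def)
  show "set (vwalk_arcs p) \<subseteq> arcs_ends (G \<restriction> S)"
  proof (rule subrelI)
    fix a b assume ab: "(a, b) \<in> set (vwalk_arcs p)"
    then have "a \<in> S" "b \<in> S"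
      using assms(2) by (auto simp: set_vwalk_arcs)
    moreover have "(a, b) \<in> arcs_ends G"
      using ab assms(1) by (auto simp: vwalk_def)
    ultimately show "(a, b) \<in> arcs_ends (G \<restriction> S)"
      by (auto simp: arcs_ends_conv)
  qed
qed

text \<open>
  From any vertex of a nearly regular path \<open>A @ u # B @ [neg u]\<close> the literal \<open>neg x\<close> is reached
  by following the path to \<open>neg u\<close> and then the contraposition of \<open>A @ [u]\<close>.
\<close>

lemma nr_path_extension:
  assumes P: "D @ z # R \<in> nr_paths (idg F) x" and reg: "regular D" and D: "D \<noteq> []"
  shows "z \<in> extensions F x D"
proof -
  obtain A u B where P_eq: "D @ z # R = A @ u # B @ [neg u]"
    and d: "distinct (map var (A @ u # B))"
    and w: "vwalk (D @ z # R) (idg F)" and h: "hd (D @ z # R) = x" and dP: "distinct (D @ z # R)"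
    using P by (rule nr_pathsE)
  define S where "S = verts (idg F) - set D"
  interpret wf_digraph "idg F \<restriction> S"
    using wf_digraph.wellformed_induce_subgraph[OF wf_digraph_idg] .
  have "vwalk (A @ [u]) (idg F)"
    using w vwalkI_append_l[of "A @ [u]" "B @ [neg u]" "idg F"] by (simp add: P_eq)
  then have "vwalk (neg u # contrapos A) (idg F)"
    using vwalk_contrapos[of "A @ [u]" F] by simp
  then have "vwalk ((D @ z # R) @ contrapos A) (idg F)"
  proof (cases "A = []")
    case False
    have "last (D @ z # R) = neg u"
      by (simp only: P_eq) simp
    then show ?thesis
      using False w \<open>vwalk (neg u # contrapos A) (idg F)\<close>
        vwalk_append_iff[of "[neg u]" "contrapos A" "idg F"]
        vwalk_append_iff[of "D @ z # R" "contrapos A" "idg F"] by simp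
  qed (use w in simp)
  then have w': "vwalk (z # R @ contrapos A) (idg F)"
    using vwalkI_append_r[of "z # R @ contrapos A" D] by simp
  have "prefix D (A @ u # B)"
  proof -
    have "butlast (D @ z # R) = D @ butlast (z # R)"
      by (simp add: butlast_append)
    moreover have "butlast (D @ z # R) = A @ u # B"
      unfolding P_eq by (simp add: butlast_append)
    ultimately show ?thesis by (metis prefixI)
  qed
  then have "set D \<subseteq> set (A @ u # B)"
    by (rule set_mono_prefix)
  \<comment> \<open>\<open>D\<close> lies on the regular part \<open>A @ u # B\<close>, which
    contains no complement of a vertex of \<open>A\<close>. So the way back along
    \<open>contrapos A\<close> avoids \<open>D\<close>; \<open>z # R\<close> avoids it by
    distinctness.\<close>
  moreover have "neg a \<notin> set (A @ u # B)" if "a \<in> set A" for a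
    using distinct_map_var_neg[OF d, of a] that by auto
  ultimately have "set (z # R @ contrapos A) \<subseteq> S"
    using dP w' by (auto simp: S_def vwalk_def)
  then have "vwalk (z # R @ contrapos A) (idg F \<restriction> S)"
    using w' by (rule vwalk_induce_subgraph[rotated])
  moreover have "last (z # R @ contrapos A) = neg x"
  proof (cases "A = []")
    case True
    then have "last (D @ z # R) = neg u" "u = x"
      using P_eq h by auto
    then show ?thesis using True by simp
  next
    case False
    then have "hd A = x"
      using P_eq h by auto
    then show ?thesis using False by (simp add: last_contrapos)
  qed
  ultimately have "z \<rightarrow>\<^sup>*\<^bsub>idg F \<restriction> S\<^esub> neg x"
    unfolding reachable_vwalk_conv by (metis list.sel(1))
  moreover have "(last D, z) \<in> arcs_ends (idg F)"
    using w D vwalk_append_iff[of D "z # R" "idg F"] by simp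
  moreover have "z \<in> verts (idg F) - set D"
    using w dP by (auto simp: vwalk_def)
  ultimately show ?thesis
    unfolding extensions_def S_def by blast
qed

text \<open>The list \<open>ps\<close> of complete paths visited is kept apart from what is printed,
  so that order and completeness of the traversal are settled before the output test
  matters.\<close>

lemma dfs_eq_output_paths:
  assumes "finite (lits F)" "linear_order_on (lits F) L"
    and "vpath (P @ [y]) (idg F)" "hd (P @ [y]) = x" "regular P"
  shows "\<exists>ps. set ps = {Q \<in> nr_paths (idg F) x. prefix (P @ [y]) Q} \<and>
    sorted_wrt (path_less L) ps \<and> dfs F x L P y = concat (map (output_path L) ps)"
  using assms
proof (induction F x L P y rule: dfs.induct)
  case (1 F x L P y)
  let ?P = "P @ [y]"
  note IH = 1(1) and prems = 1(2-6)
  show ?case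
  proof (cases "regular ?P")
    case False
    then obtain Q where "Q \<in> nr_paths (idg F) x" "prefix Q ?P"
      using nr_prefix_exists[OF prems(3,4)] by blast
    \<comment> \<open>A nearly regular path does not fit inside the regular \<open>P\<close>, so
      \<open>Q\<close> is all of \<open>?P\<close> and the call is a leaf.\<close>
    moreover have "\<not> prefix Q P"
      using nr_path_not_subset_regular[OF \<open>Q \<in> _\<close> prems(5)] set_mono_prefix by blast
    ultimately have "?P \<in> nr_paths (idg F) x"
      by auto
    then have "{Q \<in> nr_paths (idg F) x. prefix ?P Q} = {?P}"
      using nr_path_prefix_eq by blast
    moreover have "dfs F x L P y = output_path L ?P"
      using prems False by (subst dfs.simps) simp
    ultimately show ?thesis
      by (intro exI[of _ "[?P]"]) simp
  next
    case True
    define zs where "zs = [z \<leftarrow> listing L (lits F). z \<in> extensions F x ?P]"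
    have zs: "set zs = extensions F x ?P" "sorted_wrt (\<lambda>a b. (a, b) \<in> L - Id) zs"
      using listing_strict[OF prems(2,1)] by (auto simp: zs_def sorted_wrt_filter extensions_def)
    have dfs: "dfs F x L P y = concat (map (dfs F x L ?P) zs)"
      using prems True by (subst dfs.simps) (simp add: zs_def)
    have "\<forall>z\<in>set zs. \<exists>ps. set ps = {Q \<in> nr_paths (idg F) x. prefix (?P @ [z]) Q} \<and>
      sorted_wrt (path_less L) ps \<and> dfs F x L ?P z = concat (map (output_path L) ps)"
    proof (rule ballI, rule IH)
      fix z assume z: "z \<in> set zs"
      show "z \<in> set [z \<leftarrow> listing L (lits F). z \<in> extensions F x ?P]"
        using z by (simp add: zs_def)
      have "z \<in> extensions F x ?P" using z zs by simp
      then have "z \<in> lits F" "z \<notin> set ?P" "(last ?P, z) \<in> arcs_ends (idg F)"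
        by (auto simp: extensions_def)
      then show "vpath (?P @ [z]) (idg F)"
        using prems(3) unfolding vpath_def
        by (subst vwalk_append_iff) (auto simp: vwalk_def)
      show "hd (?P @ [z]) = x"
        using prems(4) by (cases P) auto
    qed (use prems True in auto)
    from bchoice[OF this] obtain f where f: "\<And>z. z \<in> set zs \<Longrightarrow>
      set (f z) = {Q \<in> nr_paths (idg F) x. prefix (?P @ [z]) Q} \<and>
      sorted_wrt (path_less L) (f z) \<and> dfs F x L ?P z = concat (map (output_path L) (f z))"
      by blast
    define ps where "ps = concat (map f zs)"
    have "dfs F x L P y = concat (map (output_path L) ps)"
    proof -
      have "map (dfs F x L ?P) zs = map (\<lambda>z. concat (map (output_path L) (f z))) zs"
        using f by auto
      also have "concat \<dots> = concat (map (output_path L) ps)"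
        unfolding ps_def by (induction zs) auto
      finally show ?thesis by (simp add: dfs)
    qed
    \<comment> \<open>Paths from different children share \<open>?P\<close> and first differ at
      \<open>z\<close> and \<open>z'\<close>, so the order of the children decides.\<close>
    moreover have "sorted_wrt (path_less L) ps"
      unfolding ps_def
    proof (rule sorted_wrt_concat_map)
      show "sorted_wrt (\<lambda>z z'. \<forall>p\<in>set (f z). \<forall>q\<in>set (f z'). path_less L p q) zs"
      proof (rule sorted_wrt_mono_rel[OF _ zs(2)])
        fix z z' assume zz: "z \<in> set zs" "z' \<in> set zs" "(z, z') \<in> L - Id"
        show "\<forall>p\<in>set (f z). \<forall>q\<in>set (f z'). path_less L p q"
        proof (intro ballI)
          fix p q assume "p \<in> set (f z)" "q \<in> set (f z')"
          then have "prefix (?P @ [z]) p" "prefix (?P @ [z']) q"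
            using f zz by auto
          then obtain p' q' where "p = ?P @ z # p'" "q = ?P @ z' # q'"
            by (auto simp: prefix_def)
          then show "path_less L p q"
            using path_less_append[OF zz(3)] by metis
        qed
      qed
    qed (use f in blast)
    moreover have "set ps = {Q \<in> nr_paths (idg F) x. prefix ?P Q}"
    proof (intro set_eqI iffI)
      fix Q assume "Q \<in> set ps"
      then obtain z where "z \<in> set zs" "Q \<in> set (f z)" by (auto simp: ps_def)
      then show "Q \<in> {Q \<in> nr_paths (idg F) x. prefix ?P Q}"
        using f append_prefixD by blast
    next
      fix Q assume "Q \<in> {Q \<in> nr_paths (idg F) x. prefix ?P Q}"
      then have Q: "Q \<in> nr_paths (idg F) x" "prefix ?P Q" by auto
      \<comment> \<open>\<open>?P\<close> is regular here, so \<open>Q\<close> continues with some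
        \<open>z\<close>, which the reachability test retains by
        \<open>nr_path_extension\<close>.\<close>
      have "Q \<noteq> ?P"
        using Q(1) True by (auto simp: nr_paths_def nearly_regular_def regular_def)
      then obtain z R where Q_eq: "Q = ?P @ z # R"
        using Q(2) by (metis append_Nil2 neq_Nil_conv prefix_def)
      then have "z \<in> set zs"
        using nr_path_extension[of ?P z R] Q(1) True zs(1) by auto
      then have "Q \<in> set (f z)"
        using f Q Q_eq by auto
      then show "Q \<in> set ps"
        using \<open>z \<in> set zs\<close> by (auto simp: ps_def)
    qed
    ultimately show ?thesis by blast
  qed
qed

lemma enum_mus_eq_output_paths:
  assumes F: "is_clause_set F" and x: "{x} \<in> F" and L: "linear_order_on (lits F) L"
  shows "\<exists>ps. set ps = nr_paths (idg F) x \<and> sorted_wrt (path_less L) ps \<and>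
    enum_mus F x L = concat (map (output_path L) ps)"
proof (cases "x \<rightarrow>\<^sup>*\<^bsub>idg F\<^esub> neg x")
  case True
  have "x \<in> lits F" using x by (auto simp: lits_def)
  then have "vpath ([] @ [x]) (idg F)"
    by (auto simp: vpath_def vwalk_def)
  moreover have "regular ([] :: 'a lit list)"
    by (simp add: regular_def compl_pairs_def)
  ultimately obtain ps where "set ps = {Q \<in> nr_paths (idg F) x. prefix ([] @ [x]) Q}"
    "sorted_wrt (path_less L) ps" "dfs F x L [] x = concat (map (output_path L) ps)"
    using dfs_eq_output_paths[OF finite_lits[OF F] L, where P = "[]" and y = x and x = x] by auto
  moreover have "prefix ([] @ [x]) Q" if "Q \<in> nr_paths (idg F) x" for Q
    using that by (cases Q) (auto simp: nr_paths_iff vwalk_def)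
  ultimately show ?thesis
    using True by (auto simp: enum_mus_def)
next
  case False
  interpret wf_digraph "idg F" by (rule wf_digraph_idg)
  \<comment> \<open>A path from \<open>x\<close> reaches both \<open>u\<close> and
    \<open>neg u\<close>, and contraposing the walk to \<open>neg u\<close> leads from
    \<open>u\<close> on to \<open>neg x\<close>. So the initial test loses nothing.\<close>
  have "nr_paths (idg F) x = {}"
  proof (rule equals0I)
    fix P assume "P \<in> nr_paths (idg F) x"
    then obtain A u B where P: "P = A @ u # B @ [neg u]" "vwalk P (idg F)" "hd P = x"
      by (rule nr_pathsE)
    have "vwalk (A @ [u]) (idg F)"
      using P vwalkI_append_l[of "A @ [u]" "B @ [neg u]"] by simp
    moreover have "hd (A @ [u]) = x"
      using P by (cases A) auto
    ultimately have "x \<rightarrow>\<^sup>*\<^bsub>idg F\<^esub> u" "x \<rightarrow>\<^sup>*\<^bsub>idg F\<^esub> neg u"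
      unfolding reachable_vwalk_conv using P by (metis last_snoc, metis append.assoc append_Cons last_snoc)
    then have "x \<rightarrow>\<^sup>*\<^bsub>idg F\<^esub> neg x"
      using reachable_contrapos[of F x "neg u"] by (auto intro: reachable_trans)
    then show False using False by blast
  qed
  then show ?thesis
    using False by (intro exI[of _ "[]"]) (simp add: enum_mus_def)
qed

theorem theorem7p3:
  fixes F :: "'v clause set" and x :: "'v lit" and L :: "'v lit rel"
  assumes "is_clause_set F"
    and "\<forall>C\<in>F. card C = 1 \<or> card C = 2"
    and "{x} \<in> F"
    and "linear_order_on (lits F) L"
  shows "set (enum_mus F x L) = mus_containing {x} F \<and>
    distinct (enum_mus F x L) \<and>
    sorted_wrt (pathlex_less_from x F L) (enum_mus F x L) \<and>
    sorted_wrt (pathlex_less F L) [F' \<leftarrow> enum_mus F x L. start_lit L F' = x]"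
proof -
  obtain ps where ps: "set ps = nr_paths (idg F) x" "sorted_wrt (path_less L) ps"
    and enum: "enum_mus F x L = concat (map (output_path L) ps)"
    using enum_mus_eq_output_paths[OF assms(1,3,4)] by blast
  \<comment> \<open>The visited paths that pass the output test, one from each pair
    \<open>P\<close>, \<open>flip P\<close>.\<close>
  define qs where "qs = [P \<leftarrow> ps. flip P = P \<or> path_less L P (flip P)]"
  have "\<forall>P\<in>set ps. output_path L P =
      (if flip P = P \<or> path_less L P (flip P) then [path_clauses P] else [])"
    using ps(1) is_unit_arc_iff_flip by (auto simp: output_path_def)
  then have enum': "enum_mus F x L = map path_clauses qs"
    unfolding enum qs_def by (induction ps) auto
  \<comment> \<open>On \<open>qs\<close>, \<open>first_path\<close> inverts
    \<open>path_clauses\<close>; this carries the order of the paths over to the printed sets, and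
    distinctness follows by irreflexivity.\<close>
  have first: "first_path F L x (path_clauses P) = P" if "P \<in> set qs" for P
    using that ps(1) by (intro first_path_eq[OF assms(4)]) (auto simp: qs_def)
  have "sorted_wrt (path_less L) qs"
    using ps(2) by (simp add: qs_def sorted_wrt_filter)
  then have sorted: "sorted_wrt (pathlex_less_from x F L) (enum_mus F x L)"
    unfolding enum' sorted_wrt_map
    by (rule sorted_wrt_mono_rel[rotated]) (simp add: pathlex_less_from_def first)
  have "set (enum_mus F x L) = path_clauses ` nr_paths (idg F) x"
  proof
    show "path_clauses ` nr_paths (idg F) x \<subseteq> set (enum_mus F x L)"
    proof (rule image_subsetI)
      fix P assume P: "P \<in> nr_paths (idg F) x"
      \<comment> \<open>By totality \<open>P\<close> or \<open>flip P\<close> passes the test, and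
        both have the same clauses, so every set is printed.\<close>
      have "flip P = P \<or> path_less L P (flip P) \<or> path_less L (flip P) P"
        using path_less_total[of "idg F" L P x "flip P"] P flip_in_nr_paths[OF P] assms(4) by auto
      then have "P \<in> set qs \<or> flip P \<in> set qs"
        using P flip_in_nr_paths[OF P] flip_flip[OF P] ps(1) by (auto simp: qs_def)
      then show "path_clauses P \<in> set (enum_mus F x L)"
        unfolding enum' set_map by (metis image_eqI path_clauses_flip[OF P])
    qed
  qed (use ps(1) in \<open>auto simp: enum' qs_def\<close>)
  \<comment> \<open>Filtering keeps sortedness, and both orders agree on sets read from
    \<open>x\<close>.\<close>
  moreover have "sorted_wrt (pathlex_less F L) [F' \<leftarrow> enum_mus F x L. start_lit L F' = x]"
    by (rule sorted_wrt_mono_rel[OF _ sorted_wrt_filter[OF sorted]])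
      (auto simp: pathlex_less_eq_from)
  moreover have "distinct (enum_mus F x L)"
    using sorted by (rule sorted_wrt_imp_distinct) (simp add: pathlex_less_from_def path_less_irrefl)
  ultimately show ?thesis
    using sorted mus_containing_eq[OF assms(3,2)] by simp
qed

end
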